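(* Let $x$ be an indeterminate. For all integers $h \geq 2$ and all integers $0 \leq n \leq h$, the coefficient of $z^n$ in the power series expansion about $z=0$ of the rational function $\mathrm{Conv}_{2,h}(x,z)$ is $$[z^n]\,\mathrm{Conv}_{2,h}(x,z) = \binom{x}{n}.$$
   Context: $x$ is an indeterminate over $\mathbb{Q}$, and $\binom{y}{n} = y(y-1)\cdots(y-n+1)/n!$ for integers $n\ge 0$. For integers $i\ge 1$ define $$c_{x,i}^{(2)} := -\frac{1}{(2i-1)(2i-3)}\bigl(x+2(i-1)^2\bigr),$$ and define $\mathrm{ab}_{x,i}^{(2)} := -\frac{1}{4(2i-3)^2}(x-i+2)(x+i-1)$ for $i\ge 3$, $\mathrm{ab}_{x,2}^{(2)} := -\frac12 x(x+1)$, and $\mathrm{ab}_{x,i}^{(2)}:=0$ otherwise. Define polynomials in $z$ by $P_{2,0}(x,z)=0$, $P_{2,1}(x,z)=1$, $Q_{2,0}(x,z)=1$, $Q_{2,1}(x,z)=1-c_{x,1}^{(2)}z$, and for $h\ge 2$ $$P_{2,h}(x,z) = (1-c_{x,h}^{(2)}z)P_{2,h-1}(x,z) - \mathrm{ab}_{x,h}^{(2)}z^2P_{2,h-2}(x,z),$$ $$Q_{2,h}(x,z) = (1-c_{x,h}^{(2)}z)Q_{2,h-1}(x,z) - \mathrm{ab}_{x,h}^{(2)}z^2Q_{2,h-2}(x,z).$$ The $h$-th convergent function is $\mathrm{Conv}_{2,h}(x,z) := P_{2,h}(x,z)/Q_{2,h}(x,z)$. Since $Q_{2,h}(x,0)=1$,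 it expands as a power series in $z$ with coefficients in $\mathbb{Q}[x]$. *)

theory Defs
  imports "HOL-Computational_Algebra.Computational_Algebra"
begin

text \<open>
  Polynomials in z over \<open>\<rat>[x]\<close> have type \<open>rat poly poly\<close>, the inner indeterminate being x;
  rational functions in z are elements of \<open>rat poly poly fract\<close>, the fraction field of
  \<open>\<rat>[x][z]\<close>, and power series in z over \<open>\<rat>[x]\<close> have type \<open>rat poly fps\<close>.
\<close>

abbreviation x_indet :: "rat poly" where
  "x_indet \<equiv> [:0, 1:]"

abbreviation z_indet :: "rat poly poly" where
  "z_indet \<equiv> [:0, 1:]"

definition c2 :: "nat \<Rightarrow> rat poly" where
  "c2 i = smult (- (1 / ((2 * of_nat i - 1) * (2 * of_nat i - 3))))
            (x_indet + 2 * (of_nat i - 1) ^ 2)"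

definition ab2 :: "nat \<Rightarrow> rat poly" where
  "ab2 i =
    (if i \<ge> 3 then smult (- (1 / (4 * (2 * of_nat i - 3) ^ 2)))
                    ((x_indet - of_nat i + 2) * (x_indet + of_nat i - 1))
     else if i = 2 then smult (- (1 / 2)) (x_indet * (x_indet + 1))
     else 0)"

fun P2 :: "nat \<Rightarrow> rat poly poly" where
  "P2 0 = 0"
| "P2 (Suc 0) = 1"
| "P2 (Suc (Suc k)) =
     (1 - smult (c2 (Suc (Suc k))) z_indet) * P2 (Suc k)
       - smult (ab2 (Suc (Suc k))) (z_indet ^ 2) * P2 k"

fun Q2 :: "nat \<Rightarrow> rat poly poly" where
  "Q2 0 = 1"
| "Q2 (Suc 0) = 1 - smult (c2 1) z_indet"
| "Q2 (Suc (Suc k)) =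
     (1 - smult (c2 (Suc (Suc k))) z_indet) * Q2 (Suc k)
       - smult (ab2 (Suc (Suc k))) (z_indet ^ 2) * Q2 k"

definition Conv2 :: "nat \<Rightarrow> rat poly poly fract" where
  "Conv2 h = Fract (P2 h) (Q2 h)"

text \<open>
  The expansion about \<open>z = 0\<close> of a rational function in z, as a power series over \<open>\<rat>[x]\<close>.
  It is meaningful for those rational functions that can be written as \<open>p / q\<close> with
  \<open>q(0) = 1\<close>; for these, existence and uniqueness are established below.
\<close>

definition expansion_at_0 :: "rat poly poly fract \<Rightarrow> rat poly fps" where
  "expansion_at_0 r =
     (THE F. \<exists>p q. coeff q 0 = 1 \<and> r = Fract p q \<and> F * fps_of_poly q = fps_of_poly p)"

lemma fps_of_poly_divide_exists:
  fixes p q :: "rat poly poly"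
  assumes "coeff q 0 = 1"
  shows "\<exists>F. F * fps_of_poly q = fps_of_poly p"
proof -
  have "fps_left_inverse (fps_of_poly q) 1 * fps_of_poly q = 1"
    by (rule fps_left_inverse) (simp add: assms)
  hence "(fps_of_poly p * fps_left_inverse (fps_of_poly q) 1) * fps_of_poly q = fps_of_poly p"
    by (simp add: mult.assoc)
  thus ?thesis by blast
qed

lemma expansion_at_0_Fract:
  assumes q: "coeff q 0 = 1" and F: "F * fps_of_poly q = fps_of_poly p"
  shows "expansion_at_0 (Fract p q) = F"
  unfolding expansion_at_0_def
proof (rule the_equality)
  show "\<exists>p' q'. coeff q' 0 = 1 \<and> Fract p q = Fract p' q' \<and> F * fps_of_poly q' = fps_of_poly p'"
    using q F by blast
next
  fix G
  assume "\<exists>p' q'. coeff q' 0 = 1 \<and> Fract p q = Fract p' q' \<and> G * fps_of_poly q' = fps_of_poly p'"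
  then obtain p' q' where q': "coeff q' 0 = 1" and eq: "Fract p q = Fract p' q'"
    and G: "G * fps_of_poly q' = fps_of_poly p'" by blast
  have nz: "q \<noteq> 0" "q' \<noteq> 0" using q q' by auto
  hence "p * q' = p' * q" using eq by (simp add: eq_fract)
  hence "fps_of_poly p * fps_of_poly q' = fps_of_poly p' * fps_of_poly q"
    by (metis fps_of_poly_mult)
  hence "(G - F) * (fps_of_poly q * fps_of_poly q') = 0"
    by (auto simp add: F [symmetric] G [symmetric] algebra_simps)
  moreover have "fps_of_poly q * fps_of_poly q' \<noteq> 0"
    using nz by simp
  ultimately show "G = F" using nz by auto
qed

lemma coeff_0_Q2: "coeff (Q2 h) 0 = 1"
  by (induction h rule: Q2.induct) (simp_all add: coeff_mult power2_eq_square)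

lemma expansion_at_0_Conv2: "expansion_at_0 (Conv2 h) * fps_of_poly (Q2 h) = fps_of_poly (P2 h)"
  using fps_of_poly_divide_exists [OF coeff_0_Q2] expansion_at_0_Fract [OF coeff_0_Q2]
  unfolding Conv2_def by metis

text \<open>
  The library's \<open>gchoose\<close> is constrained to fields of characteristic 0, so it does not
  apply to \<open>rat poly\<close>.
\<close>

definition binom_poly :: "rat poly \<Rightarrow> nat \<Rightarrow> rat poly" where
  "binom_poly y n = smult (1 / fact n) (\<Prod>i = 0..<n. y - of_nat i)"

lemma poly_binom_poly: "poly (binom_poly y n) a = poly y a gchoose n"
  by (simp add: binom_poly_def gbinomial_prod_rev poly_prod)

end

theory Submission
  imports Defs
begin

text \<open>
  Write \<open>B\<close> for the binomial series \<open>(1 + z)\<^sup>x\<close>. The convergents are Pade approximants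
  of \<open>B\<close>, and the error of a Pade approximant of \<open>(1 + z)\<^sup>x\<close> is a Gauss hypergeometric
  series in closed form:
    \<open>Q\<^sub>h B - P\<^sub>h = ab\<^sub>2 ab\<^sub>3 \<dots> ab\<^sub>h\<^sub>+\<^sub>1 z\<^bsup>2h\<^esup> F\<^sub>h\<close>, where
    \<open>F\<^sub>h = \<^sub>2F\<^sub>1(h - x, h + 1; 2h + 1; -z)\<close>
  (lemma \<open>Pade_remainder\<close>). Both sides obey the three-term recurrence that defines \<open>P\<close>
  and \<open>Q\<close>: for the left side this is linearity, for the right side it is the contiguous relation
    \<open>F\<^sub>m = (1 - c\<^sub>m\<^sub>+\<^sub>2 z) F\<^sub>m\<^sub>+\<^sub>1 - ab\<^sub>m\<^sub>+\<^sub>3 z\<^sup>2 F\<^sub>m\<^sub>+\<^sub>2\<close>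
  (lemma \<open>hyp_fps_contiguous\<close>). The initial value for \<open>h = 0\<close> is \<open>F\<^sub>0 = B\<close>, and the one for
  \<open>h = 1\<close> is a separate contiguous relation, because \<open>ab\<^sub>2\<close> is twice what the formula
  for the later \<open>ab\<^sub>i\<close> would give (lemma \<open>hyp_fps_contiguous_0\<close>).

  Hence \<open>Q\<^sub>h (B - P\<^sub>h / Q\<^sub>h)\<close> vanishes to order \<open>2h\<close>. As \<open>Q\<^sub>h\<close> has constant term 1, so does
  \<open>B - P\<^sub>h / Q\<^sub>h\<close>, and \<open>n \<le> h < 2h\<close> gives the theorem.

  The hypergeometric series have coefficients in \<open>\<rat>[x]\<close>; identities between them are checked
  coefficientwise after substituting an arbitrary rational number for \<open>x\<close>, so that field
  arithmetic becomes available.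
\<close>

section \<open>Hypergeometric series and the binomial series\<close>

definition binom_fps :: "rat poly fps" where
  "binom_fps = Abs_fps (binom_poly x_indet)"

text \<open>
  The series \<open>\<^sub>2F\<^sub>1(h - x, h + 1; 2h + 1; -z)\<close>.
\<close>
definition hyp_fps :: "nat \<Rightarrow> rat poly fps" where
  "hyp_fps h = Abs_fps (\<lambda>k.
     smult ((-1) ^ k * pochhammer (of_nat (h + 1)) k / (pochhammer (of_nat (2 * h + 1)) k * fact k))
       (pochhammer (of_nat h - x_indet) k))"

lemma poly_pochhammer: "poly (pochhammer p k) a = pochhammer (poly p a) k"
  for p :: "'a::comm_ring_1 poly"
  by (simp add: pochhammer_prod poly_prod)

lemma poly_hyp_fps_nth:
  "poly (fps_nth (hyp_fps h) k) a =
     (-1) ^ k * pochhammer (of_nat h - a) k * pochhammer (of_nat h + 1) k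
       / (pochhammer (2 * of_nat h + 1) k * fact k)"
  by (simp add: hyp_fps_def poly_pochhammer add.commute)

text \<open>
  At \<open>h = 0\<close> the parameters \<open>h + 1\<close> and \<open>2h + 1\<close> cancel, which leaves
  \<open>\<^sub>1F\<^sub>0(-x; -z) = (1 + z)\<^sup>x\<close>.
\<close>
lemma binom_fps_eq_hyp_fps: "binom_fps = hyp_fps 0"
proof (rule fps_ext)
  fix n
  have "poly (fps_nth binom_fps n) a = poly (fps_nth (hyp_fps 0) n) a" for a
    by (simp add: binom_fps_def poly_binom_poly poly_hyp_fps_nth gbinomial_pochhammer
        pochhammer_fact [symmetric])
  thus "fps_nth binom_fps n = fps_nth (hyp_fps 0) n"
    by (simp add: poly_eq_poly_eq_iff [symmetric] fun_eq_iff)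
qed

section \<open>Contiguous relations\<close>

lemma pochhammer_shifts:
  fixes z :: "'a::comm_ring_1"
  shows "pochhammer z (k + 1) = z * pochhammer (z + 1) k"
    and "pochhammer z (k + 2) = z * pochhammer (z + 1) k * (z + 1 + of_nat k)"
    and "pochhammer z (k + 2) = z * (z + 1) * pochhammer (z + 2) k"
    and "pochhammer z (k + 1) = pochhammer z k * (z + of_nat k)"
    and "pochhammer z (k + 2) = pochhammer z k * (z + of_nat k) * (z + 1 + of_nat k)"
proof -
  show r: "pochhammer z (k + 1) = z * pochhammer (z + 1) k"
    by (simp add: pochhammer_rec)
  show "pochhammer z (k + 2) = z * (z + 1) * pochhammer (z + 2) k"
    by (simp add: pochhammer_rec add.assoc mult.assoc)
  show "pochhammer z (k + 1) = pochhammer z k * (z + of_nat k)"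
    by (simp add: pochhammer_Suc)
  show "pochhammer z (k + 2) = pochhammer z k * (z + of_nat k) * (z + 1 + of_nat k)"
    by (simp add: pochhammer_Suc add_ac)
  show "pochhammer z (k + 2) = z * pochhammer (z + 1) k * (z + 1 + of_nat k)"
    using pochhammer_rec [of z "k + 1"] by (simp add: pochhammer_Suc mult_ac)
qed

text \<open>
  The contiguous relation between the coefficients of \<open>z\<^bsup>k+2\<^esup>\<close>, divided by the factor \<open>U\<close>
  common to all of its terms (see \<open>poly_hyp_fps_shifts\<close>); \<open>M\<close> is the index of the first
  series and \<open>a\<close> the value of \<open>x\<close>. What remains is an identity of rational functions.
\<close>
lemma contiguous_identity:
  fixes a M k :: rat
  assumes "M \<ge> 0" "k \<ge> 0"
  shows "(M - a) * (M + 1 - a) * ((M + 1) * (M + 2)) / ((2 * M + 1) * (2 * M + 2) * ((k + 1) * (k + 2))) =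
     (M + 1 - a) * (M + 2 - a + k) * ((M + 2) * (M + 3 + k))
       / ((2 * M + 3 + k) * (2 * M + 4 + k) * ((k + 1) * (k + 2)))
     - (a + 2 * (M + 1) ^ 2) / ((2 * M + 3) * (2 * M + 1))
       * ((M + 1 - a) * (M + 2) / ((2 * M + 3 + k) * (k + 1)))
     + (a - M - 1) * (a + M + 2) / (4 * (2 * M + 3) ^ 2)
       * ((2 * M + 3) * (2 * M + 4) / ((2 * M + 3 + k) * (2 * M + 4 + k)))"
proof -
  have nz: "2 * M + 1 \<noteq> 0" "2 * M + 2 \<noteq> 0" "2 * M + 3 \<noteq> 0" "2 * M + 3 + k \<noteq> 0" 
    "2 * M + 4 + k \<noteq> 0" "k + 1 \<noteq> 0" "k + 2 \<noteq> 0"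
    using assms by linarith+
  show ?thesis
    using nz by (simp add: divide_simps) algebra
qed


text \<open>
  The terms of the contiguous relation differ only by small shifts of the arguments and lengths
  of the rising factorials, so they are rational multiples of one quantity \<open>U\<close>. Up to
  sign, \<open>U\<close> is the product of the rising factorials of length \<open>k\<close> that start at the first
  two parameters of \<open>F\<^sub>m\<^sub>+\<^sub>2\<close> and the third parameter of \<open>F\<^sub>m\<^sub>+\<^sub>1\<close>, the last one and \<open>k!\<close>
  inverted.
\<close>
lemma poly_hyp_fps_shifts:
  fixes a :: rat and m k :: nat
  defines "M \<equiv> of_nat m" and "K \<equiv> of_nat k"
  defines "U \<equiv> (-1) ^ k * pochhammer (M + 2 - a) k * pochhammer (M + 3) k
       / (pochhammer (2 * M + 3) k * fact k)"
  shows "poly (fps_nth (hyp_fps m) (k + 2)) a =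
      U * ((M - a) * (M + 1 - a) * ((M + 1) * (M + 2))
        / ((2 * M + 1) * (2 * M + 2) * ((K + 1) * (K + 2))))"
    and "poly (fps_nth (hyp_fps (m + 1)) (k + 1)) a =
      - U * ((M + 1 - a) * (M + 2) / ((2 * M + 3 + K) * (K + 1)))"
    and "poly (fps_nth (hyp_fps (m + 1)) (k + 2)) a =
      U * ((M + 1 - a) * (M + 2 - a + K) * ((M + 2) * (M + 3 + K))
        / ((2 * M + 3 + K) * (2 * M + 4 + K) * ((K + 1) * (K + 2))))"
    and "poly (fps_nth (hyp_fps (m + 2)) k) a =
      U * ((2 * M + 3) * (2 * M + 4) / ((2 * M + 3 + K) * (2 * M + 4 + K)))"
proof -
  have "M \<ge> 0" "K \<ge> 0" by (simp_all add: M_def K_def)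
  have fact2: "fact (k + 2) = (K + 1) * (K + 2) * (fact k :: rat)"
    and fact1: "fact (k + 1) = (K + 1) * (fact k :: rat)"
    by (simp_all add: K_def algebra_simps)
  have "(2 * M + 3) * (2 * M + 4) * pochhammer (2 * M + 5) k
      = pochhammer (2 * M + 3) k * ((2 * M + 3 + K) * (2 * M + 4 + K))"
    using pochhammer_shifts(3) [of "2 * M + 3" k] pochhammer_shifts(5) [of "2 * M + 3" k]
    by (simp add: K_def add_ac mult_ac)
  moreover have nz: "2 * M + 3 \<noteq> 0" "2 * M + 4 \<noteq> 0"
    using \<open>M \<ge> 0\<close> by linarith+
  ultimately have p4: "pochhammer (2 * M + 5) k = pochhammer (2 * M + 3) k
      * ((2 * M + 3 + K) * (2 * M + 4 + K)) / ((2 * M + 3) * (2 * M + 4))"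
    by (metis mult.commute mult_eq_0_iff nonzero_eq_divide_eq)
  have a1: "pochhammer (M - a) (k + 2) = (M - a) * (M + 1 - a) * pochhammer (M + 2 - a) k"
    and b1: "pochhammer (M + 1) (k + 2) = (M + 1) * (M + 2) * pochhammer (M + 3) k"
    and c1: "pochhammer (2 * M + 1) (k + 2) = (2 * M + 1) * (2 * M + 2) * pochhammer (2 * M + 3) k"
    using pochhammer_shifts(3) [of "M - a" k] pochhammer_shifts(3) [of "M + 1" k]
      pochhammer_shifts(3) [of "2 * M + 1" k]
    by (simp_all add: add.assoc diff_add_eq)
  have a2: "pochhammer (M + 1 - a) (k + 1) = (M + 1 - a) * pochhammer (M + 2 - a) k"
    and b2: "pochhammer (M + 2) (k + 1) = (M + 2) * pochhammer (M + 3) k"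
    and c2: "pochhammer (2 * M + 3) (k + 1) = pochhammer (2 * M + 3) k * (2 * M + 3 + K)"
    using pochhammer_shifts(1) [of "M + 1 - a" k] pochhammer_shifts(1) [of "M + 2" k]
      pochhammer_shifts(4) [of "2 * M + 3" k]
    by (simp_all add: add.assoc diff_add_eq K_def)
  have a3: "pochhammer (M + 1 - a) (k + 2) = (M + 1 - a) * pochhammer (M + 2 - a) k * (M + 2 - a + K)"
    and b3: "pochhammer (M + 2) (k + 2) = (M + 2) * pochhammer (M + 3) k * (M + 3 + K)"
    and c3: "pochhammer (2 * M + 3) (k + 2)
      = pochhammer (2 * M + 3) k * (2 * M + 3 + K) * (2 * M + 4 + K)"
    using pochhammer_shifts(2) [of "M + 1 - a" k] pochhammer_shifts(2) [of "M + 2" k]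
      pochhammer_shifts(5) [of "2 * M + 3" k]
    by (simp_all add: add.assoc diff_add_eq K_def)
  have args: "of_nat (m + 1) = M + 1" "of_nat (m + 2) = M + 2"
    "M + 1 + 1 = M + 2" "M + 2 + 1 = M + 3" "2 * (M + 1) + 1 = 2 * M + 3" "2 * (M + 2) + 1 = 2 * M + 5"
    by (simp_all add: M_def)
  note nth = poly_hyp_fps_nth U_def M_def [symmetric] args
  show "poly (fps_nth (hyp_fps m) (k + 2)) a =
      U * ((M - a) * (M + 1 - a) * ((M + 1) * (M + 2))
        / ((2 * M + 1) * (2 * M + 2) * ((K + 1) * (K + 2))))"
    unfolding nth a1 b1 c1 fact2 by (simp add: mult_ac)
  show "poly (fps_nth (hyp_fps (m + 1)) (k + 1)) a =
      - U * ((M + 1 - a) * (M + 2) / ((2 * M + 3 + K) * (K + 1)))"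
    unfolding nth a2 b2 c2 fact1 by (simp add: mult_ac)
  show "poly (fps_nth (hyp_fps (m + 1)) (k + 2)) a =
      U * ((M + 1 - a) * (M + 2 - a + K) * ((M + 2) * (M + 3 + K))
        / ((2 * M + 3 + K) * (2 * M + 4 + K) * ((K + 1) * (K + 2))))"
    unfolding nth a3 b3 c3 fact2 by (simp add: mult_ac)
  show "poly (fps_nth (hyp_fps (m + 2)) k) a =
      U * ((2 * M + 3) * (2 * M + 4) / ((2 * M + 3 + K) * (2 * M + 4 + K)))"
    unfolding nth p4 by (simp add: mult_ac)
qed

text \<open>
  This is where the continued fraction comes from: the \<open>c\<^sub>i\<close> and \<open>ab\<^sub>i\<close> are the
  coefficients that relate three consecutive series \<open>F\<^sub>m\<close>.
\<close>
lemma hyp_fps_contiguous: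
  "hyp_fps m = (1 - fps_const (c2 (Suc (Suc m))) * fps_X) * hyp_fps (Suc m)
     - fps_const (ab2 (Suc (Suc (Suc m)))) * fps_X ^ 2 * hyp_fps (Suc (Suc m))"
  (is "?L = ?R")
proof (rule fps_ext)
  fix n
  have "poly (fps_nth ?L n) a = poly (fps_nth ?R n) a" for a
  proof -
    define M :: rat where "M = of_nat m"
    have c: "poly (c2 (Suc (Suc m))) a = - ((a + 2 * (M + 1) ^ 2) / ((2 * M + 3) * (2 * M + 1)))"
      by (simp add: c2_def M_def add_ac)
    have ab: "poly (ab2 (Suc (Suc (Suc m)))) a = - ((a - M - 1) * (a + M + 2) / (4 * (2 * M + 3) ^ 2))"
    proof -
      have "of_nat (Suc (Suc (Suc m))) = M + 3" by (simp add: M_def)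
      moreover have "a - (M + 3) + 2 = a - M - 1" "a + (M + 3) - 1 = a + M + 2"
        "2 * (M + 3) - 3 = 2 * M + 3"
        by simp_all
      ultimately show ?thesis by (simp add: ab2_def add_ac del: of_nat_Suc)
    qed
    have R: "?R = hyp_fps (Suc m) - fps_const (c2 (Suc (Suc m))) * (fps_X * hyp_fps (Suc m))
        - fps_const (ab2 (Suc (Suc (Suc m)))) * (fps_X ^ 2 * hyp_fps (Suc (Suc m)))"
      by (simp add: algebra_simps)
    consider "n = 0" | "n = 1" | k where "n = k + 2"
      by (metis One_nat_def add_2_eq_Suc' not0_implies_Suc)
    then show ?thesis
    proof cases
      case 1
      then show ?thesis by (simp add: R poly_hyp_fps_nth fps_X_power_mult_nth)
    next
      case 2
      have "2 * M + 1 \<noteq> 0" "2 * M + 3 \<noteq> 0"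
        using of_nat_0_le_iff [of m, where 'a = rat] unfolding M_def by linarith+
      thus ?thesis unfolding R 2
        apply (simp add: c poly_hyp_fps_nth fps_X_power_mult_nth M_def [symmetric] add_ac)
        apply (simp add: divide_simps)
        apply algebra
        done
    next
      case (3 k)
      have "M \<ge> 0" "of_nat k \<ge> (0 :: rat)"
        by (simp_all add: M_def)
      note id = contiguous_identity [OF this, of a]
      have R3: "poly (fps_nth ?R (k + 2)) a = poly (fps_nth (hyp_fps (m + 1)) (k + 2)) a
          - poly (c2 (Suc (Suc m))) a * poly (fps_nth (hyp_fps (m + 1)) (k + 1)) a
          - poly (ab2 (Suc (Suc (Suc m)))) a * poly (fps_nth (hyp_fps (m + 2)) k) a"
        unfolding R by (simp add: fps_X_power_mult_nth)
      have scale: "U * A = U * B - - c * (- U * C) - - d * (U * D)"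
        if "A = B - c * C + d * D" for U A B C D c d :: rat
        unfolding that by (simp add: algebra_simps)
      show ?thesis
        unfolding 3 R3 c ab poly_hyp_fps_shifts [of m k a] M_def [symmetric] by (rule scale [OF id])
    qed
  qed
  thus "fps_nth ?L n = fps_nth ?R n"
    by (simp add: poly_eq_poly_eq_iff [symmetric] fun_eq_iff)
qed

text \<open>
  The start of the recurrence. The series with index \<open>-1\<close> would have parameters \<open>0\<close> above
  and \<open>-1\<close> below. Its limiting value is not 1 but contains one half of the \<open>z\<^sup>2 F\<^sub>1\<close> term;
  taking the constant 1 instead moves that half to the other side, which doubles the coefficient.
\<close>
lemma hyp_fps_contiguous_0:
  "hyp_fps 0 = 1 + fps_const (c2 1) * (fps_X * hyp_fps 0)
     + fps_const (ab2 2) * (fps_X ^ 2 * hyp_fps 1)"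
  (is "?L = ?R")
proof (rule fps_ext)
  fix n
  have "poly (fps_nth ?L n) a = poly (fps_nth ?R n) a" for a
  proof -
    have c: "poly (c2 1) a = a" and ab: "poly (ab2 2) a = - (a * (a + 1) / 2)"
      by (simp_all add: c2_def ab2_def)
    consider "n = 0" | "n = 1" | k where "n = k + 2"
      by (metis One_nat_def add_2_eq_Suc' not0_implies_Suc)
    then show ?thesis
    proof cases
      case 1
      then show ?thesis by (simp add: poly_hyp_fps_nth fps_X_power_mult_nth)
    next
      case 2
      then show ?thesis by (simp add: c poly_hyp_fps_nth fps_X_power_mult_nth del: One_nat_def)
    next
      case (3 k)
      define K :: rat where "K = of_nat k"
      define V where "V = (-1) ^ k * pochhammer (1 - a) k / (fact k :: rat)"
      have nz: "K + 1 \<noteq> 0" "K + 2 \<noteq> 0"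
        using of_nat_0_le_iff [of k, where 'a = rat] unfolding K_def by linarith+
      have p: "pochhammer (- a) (k + 2) = - a * pochhammer (1 - a) k * (1 - a + K)"
        "pochhammer (- a) (k + 1) = - a * pochhammer (1 - a) k"
        using pochhammer_shifts(2) [of "- a" k] pochhammer_shifts(1) [of "- a" k]
        by (simp_all add: K_def)
      have f: "fact (k + 2) = (K + 1) * (K + 2) * (fact k :: rat)"
        "fact (k + 1) = (K + 1) * (fact k :: rat)"
        by (simp_all add: K_def algebra_simps)
      have e0: "poly (fps_nth (hyp_fps 0) j) a = (-1) ^ j * pochhammer (- a) j / fact j" for j
        by (simp add: poly_hyp_fps_nth pochhammer_fact [symmetric])
      have q: "pochhammer 2 k = (fact (k + 1) :: rat)" "2 * pochhammer 3 k = (fact (k + 2) :: rat)"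
        using pochhammer_shifts(1) [of "1 :: rat" k] pochhammer_shifts(3) [of "1 :: rat" k]
        unfolding pochhammer_fact [symmetric] by (simp_all del: fact_Suc)
      have p3: "pochhammer 3 k = (K + 1) * (K + 2) * (fact k :: rat) / 2"
        using q(2) f(1) by linarith
      have "poly (fps_nth (hyp_fps 1) k) a
          = (-1) ^ k * pochhammer (1 - a) k * pochhammer 2 k / (pochhammer 3 k * fact k)"
        by (simp add: poly_hyp_fps_nth)
      hence e1: "poly (fps_nth (hyp_fps 1) k) a = V * 2 / (K + 2)"
        unfolding q(1) p3 f(2) V_def using nz by (simp add: mult_ac)
      have R3: "poly (fps_nth ?R (k + 2)) a = a * poly (fps_nth (hyp_fps 0) (k + 1)) a
          - a * (a + 1) / 2 * poly (fps_nth (hyp_fps 1) k) a"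
        by (simp add: fps_X_power_mult_nth c [unfolded One_nat_def] ab)
      have "poly (fps_nth ?L (k + 2)) a = V * (- a * (1 - a + K)) / ((K + 1) * (K + 2))"
        "poly (fps_nth ?L (k + 1)) a = V * a / (K + 1)"
        unfolding e0 p f V_def by (simp_all add: mult_ac)
      thus ?thesis
        unfolding 3 R3 e1 using nz by (simp add: divide_simps) algebra
    qed
  qed
  thus "fps_nth ?L n = fps_nth ?R n"
    by (simp add: poly_eq_poly_eq_iff [symmetric] fun_eq_iff)
qed

section \<open>The Pade remainder\<close>

lemma fps_of_poly_Q2_rec:
  "fps_of_poly (Q2 (Suc (Suc k))) =
     (1 - fps_const (c2 (Suc (Suc k))) * fps_X) * fps_of_poly (Q2 (Suc k))
       - fps_const (ab2 (Suc (Suc k))) * fps_X ^ 2 * fps_of_poly (Q2 k)"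
  and fps_of_poly_P2_rec:
  "fps_of_poly (P2 (Suc (Suc k))) =
     (1 - fps_const (c2 (Suc (Suc k))) * fps_X) * fps_of_poly (P2 (Suc k))
       - fps_const (ab2 (Suc (Suc k))) * fps_X ^ 2 * fps_of_poly (P2 k)"
  by (simp_all only: Q2.simps P2.simps fps_of_poly_diff fps_of_poly_mult fps_of_poly_smult
        fps_of_poly_power fps_of_poly_fps_X fps_of_poly_1)

text \<open>
  The product of the \<open>ab\<^sub>i\<close> is forced: the coefficient of \<open>z\<^bsup>2h\<^esup>\<close> must cancel in passing to
  \<open>h + 1\<close>, which means \<open>K\<^sub>h = ab\<^sub>h\<^sub>+\<^sub>1 K\<^sub>h\<^sub>-\<^sub>1\<close> for the leading coefficients \<open>K\<close>.
\<close>
lemma Pade_remainder: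
  "fps_of_poly (Q2 h) * binom_fps - fps_of_poly (P2 h) =
     fps_const (\<Prod>i = 2..Suc h. ab2 i) * fps_X ^ (2 * h) * hyp_fps h"
proof (induction h rule: Q2.induct)
  case 1
  show ?case by (simp add: binom_fps_eq_hyp_fps)
next
  case 2
  have "(1 - fps_const (c2 1) * fps_X) * hyp_fps 0 - 1 = fps_const (ab2 2) * fps_X ^ 2 * hyp_fps 1"
    using hyp_fps_contiguous_0 by (simp add: algebra_simps)
  thus ?case
    by (simp only: binom_fps_eq_hyp_fps P2.simps Q2.simps fps_of_poly_diff fps_of_poly_smult
        fps_of_poly_fps_X fps_of_poly_1) (simp add: numeral_2_eq_2)
next
  case (3 m)
  define K where "K = fps_const (\<Prod>i = 2..Suc m. ab2 i)"
  define A where "A = fps_const (ab2 (Suc (Suc m)))"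
  define A' where "A' = fps_const (ab2 (Suc (Suc (Suc m))))"
  define C where "C = fps_const (c2 (Suc (Suc m)))"
  have prods: "fps_const (\<Prod>i = 2..Suc (Suc m). ab2 i) = K * A"
    "fps_const (\<Prod>i = 2..Suc (Suc (Suc m)). ab2 i) = K * A * A'"
    by (simp_all add: K_def A_def A'_def prod.nat_ivl_Suc' mult_ac)
  have "fps_of_poly (Q2 (Suc (Suc m))) * binom_fps - fps_of_poly (P2 (Suc (Suc m)))
    = (1 - C * fps_X) * (fps_of_poly (Q2 (Suc m)) * binom_fps - fps_of_poly (P2 (Suc m)))
      - A * fps_X ^ 2 * (fps_of_poly (Q2 m) * binom_fps - fps_of_poly (P2 m))"
    unfolding fps_of_poly_Q2_rec fps_of_poly_P2_rec A_def C_def by (simp add: algebra_simps)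
  also have "\<dots> = K * A * fps_X ^ (2 * Suc m) * ((1 - C * fps_X) * hyp_fps (Suc m) - hyp_fps m)"
    unfolding 3 prods K_def [symmetric] by (simp add: algebra_simps power2_eq_square)
  also have "(1 - C * fps_X) * hyp_fps (Suc m) - hyp_fps m = A' * fps_X ^ 2 * hyp_fps (Suc (Suc m))"
    unfolding C_def A'_def by (subst (2) hyp_fps_contiguous) simp
  finally show ?case
    unfolding prods by (simp add: algebra_simps power2_eq_square)
qed

lemma fps_nth_eq_0_if_unit_mult:
  fixes F G :: "'a::idom fps"
  assumes F0: "fps_nth F 0 = 1" and zero: "\<And>j. j \<le> N \<Longrightarrow> fps_nth (F * G) j = 0"
    and "n \<le> N"
  shows "fps_nth G n = 0"
proof (cases "G = 0")
  case False
  have "subdegree F = 0" using F0 by (intro subdegreeI) auto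
  moreover have "F \<noteq> 0" using F0 by auto
  ultimately have "subdegree (F * G) = subdegree G" "F * G \<noteq> 0"
    using False by simp_all
  hence "N < subdegree G"
    using zero nth_subdegree_nonzero [of "F * G"] by (metis linorder_not_le)
  thus ?thesis using \<open>n \<le> N\<close> by (intro nth_less_subdegree_zero) simp
qed simp

theorem mainTheorem2:
  fixes h n :: nat
  assumes "h \<ge> 2" and "n \<le> h"
  shows "fps_nth (expansion_at_0 (Conv2 h)) n = binom_poly x_indet n"
proof -
  define G where "G = binom_fps - expansion_at_0 (Conv2 h)"
  have "fps_of_poly (Q2 h) * G = fps_of_poly (Q2 h) * binom_fps - fps_of_poly (P2 h)"
    using expansion_at_0_Conv2 [of h] by (simp add: G_def right_diff_distrib mult.commute)
  also have "\<dots> = fps_X ^ (2 * h) * (fps_const (\<Prod>i = 2..Suc h. ab2 i) * hyp_fps h)"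
    unfolding Pade_remainder by (simp only: mult.assoc mult.left_commute)
  finally have zero: "fps_nth (fps_of_poly (Q2 h) * G) j = 0" if "j \<le> h" for j
    using that assms(1) by (simp add: fps_X_power_mult_nth)
  have "fps_nth (fps_of_poly (Q2 h)) 0 = 1"
    by (simp add: coeff_0_Q2)
  hence "fps_nth G n = 0"
    using zero assms(2) by (rule fps_nth_eq_0_if_unit_mult)
  thus ?thesis
    by (simp add: G_def binom_fps_def)
qed

end
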